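(* Let $S=(\langle a_j,b_j,S_j\rangle)_{j\in J}$ be a continuous t-conorm and $T=(\langle c_i,d_i,T_i\rangle)_{i\in I}$ a continuous t-norm, represented as ordinal sums of continuous Archimedean summands. For each $j\in J$ let $s_j$ be an additive generator of $S_j$, and for each $i\in I$ let $t_i$ be an additive generator of $T_i$. Let $\Lambda=\{(j,i)\in J\times I : \,]a_j,b_j[\,\cap\,]c_i,d_i[\,\neq\emptyset\}$, and for $(j,i)\in\Lambda$ put $l_{ji}=\max\{a_j,c_i\}$ and $r_{ji}=\min\{b_j,d_i\}$. Then $S$ weakly dominates $T$ if and only if for every $(j,i)\in\Lambda$ the function $h_{ji}=s_j\circ t_i^{-1}$ is convex on $[t_i(r_{ji}),t_i(l_{ji})]$.
   Context: Open intervals are written $]p,q[$. For $[p,q]\subseteq[0,1]$ with $p<q$, a t-norm (t-conorm) on $[p,q]$ is an associative, commutative map $[p,q]^2\to[p,q]$, nondecreasing in each variable, with neutral element $q$ (respectively $p$); on $[0,1]$ it is simply called a t-norm (t-conorm). A t-conorm $S$ weakly dominates a t-norm $T$ (written $S\gg_w T$) if $S(T(x,y),z)\ge T(S(x,z),y)$ for all $x,y,z\in[0,1]$. A continuous t-norm $T$ on $[c,d]$ is Archimedean if $T(x,x)<x$ for all $x\in\,]c,d[$; an additive generator of it is a continuous strictly decreasing $t\colon[c,d]\to[0,\infty]$ with $t(d)=0$ and $T(x,y)=t^{-1}(\min\{t(x)+t(y),t(c)\})$. A continuous t-conorm $S$ on $[a,b]$ is Archimedean if $S(x,x)>x$ for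 all $x\in\,]a,b[$; an additive generator of it is a continuous strictly increasing $s\colon[a,b]\to[0,\infty]$ with $s(a)=0$ and $S(x,y)=s^{-1}(\min\{s(x)+s(y),s(b)\})$. Every continuous Archimedean t-norm or t-conorm has an additive generator. Ordinal sums: for a (possibly empty) family of pairwise disjoint nonempty open intervals $]c_i,d_i[\,\subseteq[0,1]$, $i\in I$, and continuous Archimedean t-norms $T_i$ on $[c_i,d_i]$, $T=(\langle c_i,d_i,T_i\rangle)_{i\in I}$ is the t-norm with $T(x,y)=T_i(x,y)$ if $(x,y)\in[c_i,d_i]^2$ for some $i$, and $T(x,y)=\min\{x,y\}$ otherwise. Similarly, for pairwise disjoint nonempty open intervals $]a_j,b_j[\,\subseteq[0,1]$, $j\in J$, and continuous Archimedean t-conorms $S_j$ on $[a_j,b_j]$, $S=(\langle a_j,b_j,S_j\rangle)_{j\in J}$ is the t-conorm with $S(x,y)=S_j(x,y)$ if $(x,y)\in[a_j,b_j]^2$ for some $j$, and $S(x,y)=\max\{x,y\}$ otherwise. The function $h_{ji}$ is considered on $[t_i(r_{ji}),t_i(l_{ji})]\subseteq[0,\infty]$ with values in $[0,\infty]$. Convexity means $h(\lambda\xi_1+(1-\lambda)\xi_2)\le\lambda h(\xi_1)+(1-\lambda)h(\xi_2)$ for all finite $\xi_1,\xi_2$ in the interval and all $\lambda\in\,]0,1[$, with the usual arithmetic in $[0,\infty]$. *)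

theory Defs
  imports "HOL-Analysis.Analysis"
begin

text \<open>
  Operations on a subinterval of the reals are total functions on the reals; every notion below
  only refers to their values on the interval in question.
\<close>

definition comm_monoid_op_on :: "real \<Rightarrow> real \<Rightarrow> (real \<Rightarrow> real \<Rightarrow> real) \<Rightarrow> real \<Rightarrow> bool" where
  "comm_monoid_op_on p q F e \<longleftrightarrow>
     (\<forall>x\<in>{p..q}. \<forall>y\<in>{p..q}. F x y \<in> {p..q}) \<and>
     (\<forall>x\<in>{p..q}. \<forall>y\<in>{p..q}. \<forall>z\<in>{p..q}. F (F x y) z = F x (F y z)) \<and>
     (\<forall>x\<in>{p..q}. \<forall>y\<in>{p..q}. F x y = F y x) \<and>
     (\<forall>x\<in>{p..q}. \<forall>x'\<in>{p..q}. \<forall>y\<in>{p..q}. x \<le> x' \<longrightarrow> F x y \<le> F x' y) \<and>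
     (\<forall>x\<in>{p..q}. \<forall>y\<in>{p..q}. \<forall>y'\<in>{p..q}. y \<le> y' \<longrightarrow> F x y \<le> F x y') \<and>
     (\<forall>x\<in>{p..q}. F e x = x \<and> F x e = x)"

definition tnorm_on :: "real \<Rightarrow> real \<Rightarrow> (real \<Rightarrow> real \<Rightarrow> real) \<Rightarrow> bool" where
  "tnorm_on p q T \<longleftrightarrow> comm_monoid_op_on p q T q"

definition tconorm_on :: "real \<Rightarrow> real \<Rightarrow> (real \<Rightarrow> real \<Rightarrow> real) \<Rightarrow> bool" where
  "tconorm_on p q S \<longleftrightarrow> comm_monoid_op_on p q S p"

definition continuous_op_on :: "real \<Rightarrow> real \<Rightarrow> (real \<Rightarrow> real \<Rightarrow> real) \<Rightarrow> bool" where
  "continuous_op_on p q F \<longleftrightarrow> continuous_on ({p..q} \<times> {p..q}) (\<lambda>(x, y). F x y)"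

definition weakly_dominates :: "(real \<Rightarrow> real \<Rightarrow> real) \<Rightarrow> (real \<Rightarrow> real \<Rightarrow> real) \<Rightarrow> bool" where
  "weakly_dominates S T \<longleftrightarrow>
     (\<forall>x\<in>{0..1}. \<forall>y\<in>{0..1}. \<forall>z\<in>{0..1}. S (T x y) z \<ge> T (S x z) y)"

definition archimedean_tnorm_on :: "real \<Rightarrow> real \<Rightarrow> (real \<Rightarrow> real \<Rightarrow> real) \<Rightarrow> bool" where
  "archimedean_tnorm_on c d T \<longleftrightarrow>
     tnorm_on c d T \<and> continuous_op_on c d T \<and> (\<forall>x\<in>{c<..<d}. T x x < x)"

definition archimedean_tconorm_on :: "real \<Rightarrow> real \<Rightarrow> (real \<Rightarrow> real \<Rightarrow> real) \<Rightarrow> bool" where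
  "archimedean_tconorm_on a b S \<longleftrightarrow>
     tconorm_on a b S \<and> continuous_op_on a b S \<and> (\<forall>x\<in>{a<..<b}. S x x > x)"

definition tnorm_generator ::
  "real \<Rightarrow> real \<Rightarrow> (real \<Rightarrow> real \<Rightarrow> real) \<Rightarrow> (real \<Rightarrow> ennreal) \<Rightarrow> bool" where
  "tnorm_generator c d T t \<longleftrightarrow>
     continuous_on {c..d} t \<and> strict_antimono_on {c..d} t \<and> t d = 0 \<and>
     (\<forall>x\<in>{c..d}. \<forall>y\<in>{c..d}. T x y = inv_into {c..d} t (min (t x + t y) (t c)))"

definition tconorm_generator ::
  "real \<Rightarrow> real \<Rightarrow> (real \<Rightarrow> real \<Rightarrow> real) \<Rightarrow> (real \<Rightarrow> ennreal) \<Rightarrow> bool" where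
  "tconorm_generator a b S s \<longleftrightarrow>
     continuous_on {a..b} s \<and> strict_mono_on {a..b} s \<and> s a = 0 \<and>
     (\<forall>x\<in>{a..b}. \<forall>y\<in>{a..b}. S x y = inv_into {a..b} s (min (s x + s y) (s b)))"

definition interval_family :: "'k set \<Rightarrow> ('k \<Rightarrow> real) \<Rightarrow> ('k \<Rightarrow> real) \<Rightarrow> bool" where
  "interval_family K p q \<longleftrightarrow>
     (\<forall>k\<in>K. 0 \<le> p k \<and> p k < q k \<and> q k \<le> 1) \<and>
     disjoint_family_on (\<lambda>k. {p k<..<q k}) K"

text \<open>
  Two of the squares below can only meet in a common corner \<open>(u, u)\<close>, where each of the two
  summands takes the value \<open>u\<close>; so the values prescribed for an ordinal sum are consistent.
\<close>

definition tnorm_ordinal_sum ::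
  "'k set \<Rightarrow> ('k \<Rightarrow> real) \<Rightarrow> ('k \<Rightarrow> real) \<Rightarrow> ('k \<Rightarrow> real \<Rightarrow> real \<Rightarrow> real) \<Rightarrow>
     (real \<Rightarrow> real \<Rightarrow> real) \<Rightarrow> bool" where
  "tnorm_ordinal_sum I c d TT T \<longleftrightarrow>
     interval_family I c d \<and>
     (\<forall>i\<in>I. archimedean_tnorm_on (c i) (d i) (TT i)) \<and>
     (\<forall>i\<in>I. \<forall>x\<in>{c i..d i}. \<forall>y\<in>{c i..d i}. T x y = TT i x y) \<and>
     (\<forall>x\<in>{0..1}. \<forall>y\<in>{0..1}.
        (\<nexists>i. i \<in> I \<and> x \<in> {c i..d i} \<and> y \<in> {c i..d i}) \<longrightarrow> T x y = min x y)"

definition tconorm_ordinal_sum ::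
  "'k set \<Rightarrow> ('k \<Rightarrow> real) \<Rightarrow> ('k \<Rightarrow> real) \<Rightarrow> ('k \<Rightarrow> real \<Rightarrow> real \<Rightarrow> real) \<Rightarrow>
     (real \<Rightarrow> real \<Rightarrow> real) \<Rightarrow> bool" where
  "tconorm_ordinal_sum J a b SS S \<longleftrightarrow>
     interval_family J a b \<and>
     (\<forall>j\<in>J. archimedean_tconorm_on (a j) (b j) (SS j)) \<and>
     (\<forall>j\<in>J. \<forall>x\<in>{a j..b j}. \<forall>y\<in>{a j..b j}. S x y = SS j x y) \<and>
     (\<forall>x\<in>{0..1}. \<forall>y\<in>{0..1}.
        (\<nexists>j. j \<in> J \<and> x \<in> {a j..b j} \<and> y \<in> {a j..b j}) \<longrightarrow> S x y = max x y)"

text \<open>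
  Only finite arguments are combined, but the values of \<open>h\<close> may be infinite. The library's
  \<open>convex_on\<close> needs a real vector space as its domain and real values.
\<close>

definition ennreal_convex_on :: "ennreal set \<Rightarrow> (ennreal \<Rightarrow> ennreal) \<Rightarrow> bool" where
  "ennreal_convex_on X h \<longleftrightarrow>
     (\<forall>\<xi>\<^sub>1\<in>X. \<forall>\<xi>\<^sub>2\<in>X. \<forall>l\<in>{0<..<1::real}. \<xi>\<^sub>1 < \<infinity> \<and> \<xi>\<^sub>2 < \<infinity> \<longrightarrow>
        h (ennreal l * \<xi>\<^sub>1 + ennreal (1 - l) * \<xi>\<^sub>2) \<le> ennreal l * h \<xi>\<^sub>1 + ennreal (1 - l) * h \<xi>\<^sub>2)"

definition overlap_pairs ::
  "'j set \<Rightarrow> ('j \<Rightarrow> real) \<Rightarrow> ('j \<Rightarrow> real) \<Rightarrow> 'i set \<Rightarrow> ('i \<Rightarrow> real) \<Rightarrow> ('i \<Rightarrow> real) \<Rightarrow> ('j \<times> 'i) set"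
  where
  "overlap_pairs J a b I c d = {(j, i) \<in> J \<times> I. {a j<..<b j} \<inter> {c i<..<d i} \<noteq> {}}"

end

theory Submission imports Defs begin

text \<open>
  The inequality \<open>T (S x z) y \<le> S (T x y) z\<close> is trivial unless \<open>T x y < min x y\<close> and
  \<open>S x z > max x z\<close>, that is, unless \<open>x, y\<close> lie inside one t-norm summand and \<open>x, z\<close> inside one
  t-conorm summand. For such a pair of summands, put \<open>u = T x y\<close> and \<open>v = S x z\<close>.

  If \<open>S u z < w\<close> with \<open>w = T v y\<close>, then, after \<open>u\<close> and \<open>v\<close> are clipped to the common interval
  of the two summands, the generators satisfy \<open>t x + t w \<ge> t u + t v\<close> and
  \<open>s x + s w > s u + s v\<close>, with \<open>x\<close> and \<open>w\<close> between \<open>u\<close> and \<open>v\<close>; this contradicts convexity of the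
  decreasing function \<open>s \<circ> t\<^sup>-\<^sup>1\<close>. Conversely, given \<open>u \<le> x \<le> v\<close> with \<open>2 * t x = t u + t v\<close>, one
  can choose \<open>y, z\<close> with \<open>T x y = u\<close>, \<open>S x z = v\<close> and then \<open>T v y = x\<close>, so weak domination reads
  \<open>x \<le> S u z\<close>, which is midpoint convexity; continuity does the rest.
\<close>

section \<open>Midpoint convexity and majorization\<close>

lemma convex_on_midpoint_continuous:
  fixes f :: "real \<Rightarrow> real"
  assumes cont: "continuous_on {p..q} f"
    and mid: "\<And>x y. x \<in> {p..q} \<Longrightarrow> y \<in> {p..q} \<Longrightarrow> 2 * f ((x + y) / 2) \<le> f x + f y"
  shows "convex_on {p..q} f"
proof (rule convex_on_linorderI)
  fix l x y :: real
  assume l: "0 < l" "l < 1" and xy: "x \<in> {p..q}" "y \<in> {p..q}" "x < y"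
  \<comment> \<open>If \<open>f\<close> minus its chord attains its maximum at \<open>m\<close>, it attains it at \<open>m \<plusminus> e\<close> too, one of which
    is an end point, where the difference vanishes.\<close>
  define k where "k = (f y - f x) / (y - x)"
  define g where "g = (\<lambda>\<xi>. f \<xi> - (f x + k * (\<xi> - x)))"
  have sub: "{x..y} \<subseteq> {p..q}" using xy by auto
  have "continuous_on {x..y} g"
    unfolding g_def by (intro continuous_intros continuous_on_subset[OF cont sub])
  then obtain m where m: "m \<in> {x..y}" "\<And>\<xi>. \<xi> \<in> {x..y} \<Longrightarrow> g \<xi> \<le> g m"
    using continuous_attains_sup[of "{x..y}" g] xy by force
  define e where "e = min (m - x) (y - m)"
  have ends: "g x = 0" "g y = 0" using xy by (simp_all add: g_def k_def)
  have e: "m - e \<in> {x..y}" "m + e \<in> {x..y}" using m(1) by (auto simp: e_def)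
  have "2 * f m \<le> f (m - e) + f (m + e)"
    using mid[of "m - e" "m + e"] e sub by force
  then have "2 * g m \<le> g (m - e) + g (m + e)"
    by (simp add: g_def algebra_simps)
  with m(2)[OF e(1)] m(2)[OF e(2)] have "g (m - e) = g m" "g (m + e) = g m"
    by linarith+
  moreover have "m - e = x \<or> m + e = y" by (auto simp: e_def)
  ultimately have "g m = 0" using ends by metis
  moreover have "(1 - l) * x + l * y \<in> {x..y}"
    using convexD_alt[of "{x..y}" x y l] l xy by simp
  ultimately have "g ((1 - l) * x + l * y) \<le> 0" using m(2) by metis
  then have "f ((1 - l) * x + l * y) \<le> f x + k * (l * (y - x))"
    by (simp add: g_def algebra_simps)
  also have "k * (l * (y - x)) = l * (f y - f x)" using xy by (simp add: k_def)
  finally show "f ((1 - l) *\<^sub>R x + l *\<^sub>R y) \<le> (1 - l) * f x + l * f y"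
    by (simp add: algebra_simps)
qed simp

text \<open>If \<open>h\<close> is infinite at the smaller point \<open>p\<close>, the right-hand
  side is infinite, because \<open>p\<close> has positive weight. Otherwise monotonicity bounds
  \<open>h\<close> on the whole segment by its value at \<open>p\<close>, and the criterion for
  real-valued functions applies.\<close>

lemma ennreal_convex_onI_midpoint:
  fixes h :: "ennreal \<Rightarrow> ennreal"
  assumes cont: "continuous_on {A..B} h" and anti: "antimono_on {A..B} h"
    and mid: "\<And>p q m. \<lbrakk>A \<le> ennreal p; 0 \<le> p; p \<le> q; ennreal q \<le> B; 2 * m = p + q\<rbrakk> \<Longrightarrow>
      2 * h (ennreal m) \<le> h (ennreal p) + h (ennreal q)"
  shows "ennreal_convex_on {A..B} h"
proof -
  have main: "h (ennreal l * ennreal p + ennreal (1 - l) * ennreal q)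
      \<le> ennreal l * h (ennreal p) + ennreal (1 - l) * h (ennreal q)"
    if l: "0 < l" "l < 1" and pq: "A \<le> ennreal p" "0 \<le> p" "p \<le> q" "ennreal q \<le> B" for l p q
  proof (cases "h (ennreal p) = \<infinity>")
    case True
    then show ?thesis using l by (simp add: ennreal_mult_eq_top_iff ennreal_mult_top)
  next
    case False
    have mem: "ennreal \<xi> \<in> {A..B}" if "\<xi> \<in> {p..q}" for \<xi>
      using that pq by (auto intro: order_trans ennreal_leI)
    have fin: "h (ennreal \<xi>) < \<infinity>" if "\<xi> \<in> {p..q}" for \<xi>
    proof -
      have "h (ennreal \<xi>) \<le> h (ennreal p)"
        using that pq by (intro monotone_onD[OF anti] mem ennreal_leI) auto
      then show ?thesis using False by (simp add: less_top[symmetric] top_unique neq_top_trans)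
    qed
    \<comment> \<open>\<open>enn2real\<close> sends infinity to 0, so \<open>f\<close> is a faithful
      and continuous copy of \<open>h\<close> only because \<open>h\<close> is finite on the
      segment.\<close>
    define f where "f = (\<lambda>\<xi>. enn2real (h (ennreal \<xi>)))"
    have hf: "h (ennreal \<xi>) = ennreal (f \<xi>)" if "\<xi> \<in> {p..q}" for \<xi>
      using fin[OF that] by (simp add: f_def)
    have f0: "0 \<le> f \<xi>" for \<xi> by (simp add: f_def)
    have "continuous_on {p..q} f"
    proof -
      have "continuous_on {p..q} (\<lambda>\<xi>. h (ennreal \<xi>))"
        using mem by (intro continuous_on_compose2[OF cont] continuous_on_ennreal continuous_on_id) auto
      then show ?thesis
        using fin unfolding f_def continuous_on_def
        by (auto intro!: tendsto_enn2real simp: less_top)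
    qed
    moreover have "2 * f ((x + y) / 2) \<le> f x + f y" if "x \<in> {p..q}" "y \<in> {p..q}" for x y
      using that
    proof (induction x y rule: linorder_wlog)
      case (le x y)
      then have "2 * h (ennreal ((x + y) / 2)) \<le> h (ennreal x) + h (ennreal y)"
        using pq mem[of x] mem[of y] by (intro mid) auto
      then have "ennreal (2 * f ((x + y) / 2)) \<le> ennreal (f x + f y)"
        using le hf f0 by (simp add: ennreal_mult ennreal_plus)
      then show ?case using f0 by (simp add: ennreal_le_iff ennreal_plus[symmetric] del: ennreal_plus)
    next
      case (sym x y)
      then show ?case by (simp add: add.commute)
    qed
    ultimately have "convex_on {p..q} f" by (rule convex_on_midpoint_continuous)
    from convex_onD[OF this, of "1 - l" p q]
    have "f (l * p + (1 - l) * q) \<le> l * f p + (1 - l) * f q" using l pq by simp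
    moreover have "l * p + (1 - l) * q \<in> {p..q}"
      using convexD_alt[of "{p..q}" p q "1 - l"] l pq by simp
    ultimately show ?thesis
      using l pq f0 by (simp add: hf ennreal_mult[symmetric] ennreal_plus[symmetric] ennreal_leI
          del: ennreal_plus)
  qed
  show ?thesis
    unfolding ennreal_convex_on_def
  proof (intro ballI impI; elim conjE)
    fix \<xi>\<^sub>1 \<xi>\<^sub>2 and l :: real
    assume *: "\<xi>\<^sub>1 \<in> {A..B}" "\<xi>\<^sub>2 \<in> {A..B}" "l \<in> {0<..<1}" "\<xi>\<^sub>1 < \<infinity>" "\<xi>\<^sub>2 < \<infinity>"
    then obtain p q where pq: "\<xi>\<^sub>1 = ennreal p" "0 \<le> p" "\<xi>\<^sub>2 = ennreal q" "0 \<le> q"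
      by (metis infinity_ennreal_def less_top_ennreal)
    show "h (ennreal l * \<xi>\<^sub>1 + ennreal (1 - l) * \<xi>\<^sub>2) \<le> ennreal l * h \<xi>\<^sub>1 + ennreal (1 - l) * h \<xi>\<^sub>2"
    proof (cases "p \<le> q")
      case True
      then show ?thesis using main[of l p q] * pq by simp
    next
      case False
      then show ?thesis using main[of "1 - l" q p] * pq by (simp add: add.commute)
    qed
  qed
qed

text \<open>This is the two-point case of weak majorization. As \<open>h\<close> is decreasing,
  \<open>\<eta>\<close> may be lowered until the two sums agree. The inner points are then convex
  combinations of \<open>U\<close> and \<open>V\<close> with exchanged weights, and the two
  convexity estimates add up to the claim.\<close>

lemma ennreal_convex_on_majorization:
  assumes conv: "ennreal_convex_on X h" and anti: "antimono_on X h"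
    and mem: "U \<in> X" "V \<in> X" "\<xi> \<in> X" "\<eta> \<in> X"
    and ord: "V \<le> \<xi>" "\<xi> \<le> U" "V \<le> \<eta>" "\<eta> \<le> U" and fin: "U < \<infinity>"
    and sum: "U + V \<le> \<xi> + \<eta>" and interval: "{V..U} \<subseteq> X"
  shows "h \<xi> + h \<eta> \<le> h U + h V"
proof -
  have "\<xi> < \<infinity>" "\<eta> < \<infinity>" "V < \<infinity>" using ord fin le_less_trans by blast+
  with fin obtain u v x w where r: "U = ennreal u" "V = ennreal v" "\<xi> = ennreal x" "\<eta> = ennreal w"
    and nn: "0 \<le> u" "0 \<le> v" "0 \<le> x" "0 \<le> w"
    by (metis infinity_ennreal_def less_top_ennreal)
  have o: "v \<le> x" "x \<le> u" "v \<le> w" "w \<le> u" "u + v \<le> x + w"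
    using ord sum nn unfolding r by (simp_all add: ennreal_plus[symmetric] del: ennreal_plus)
  consider "x = u" | "x = v" | "v < x" "x < u" using o by linarith
  then show ?thesis
  proof cases
    case 1
    then show ?thesis using monotone_onD[OF anti, of V \<eta>] mem ord r by (simp add: add_mono)
  next
    case 2
    then have "w = u" using o by linarith
    then show ?thesis using 2 r by (simp add: add.commute)
  next
    case 3
    define l where "l = (x - v) / (u - v)"
    have l: "0 < l" "l < 1" using 3 by (auto simp: l_def field_simps)
    have "l * (u - v) = x - v" using 3 by (simp add: l_def)
    then have x: "x = l * u + (1 - l) * v" by (simp add: algebra_simps)
    \<comment> \<open>the reflection of \<open>x\<close> in the midpoint of \<open>u\<close> and \<open>v\<close>\<close>
    define w' where "w' = (1 - l) * u + l * v"
    have w': "w' = u + v - x" unfolding w'_def x by (simp add: algebra_simps)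
    have "v \<le> w'" "w' \<le> w" "w' \<le> u" using w' o by auto
    have in_X: "ennreal w' \<in> X"
      using interval \<open>v \<le> w'\<close> \<open>w' \<le> u\<close> r by (auto intro!: ennreal_leI)
    have X: "h (ennreal k * U + ennreal (1 - k) * V) \<le> ennreal k * h U + ennreal (1 - k) * h V"
      if "0 < k" "k < 1" for k
      using conv mem fin \<open>V < \<infinity>\<close> that unfolding ennreal_convex_on_def by auto
    have e: "ennreal k * U + ennreal (1 - k) * V = ennreal (k * u + (1 - k) * v)"
      if "0 < k" "k < 1" for k
      using that nn r by (simp add: ennreal_mult[symmetric] ennreal_plus[symmetric] del: ennreal_plus)
    have "h \<xi> \<le> ennreal l * h U + ennreal (1 - l) * h V"
      using X[OF l] e[OF l] x r by simp
    moreover have "h \<eta> \<le> ennreal (1 - l) * h U + ennreal l * h V"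
    proof -
      have "h \<eta> \<le> h (ennreal w')"
        using \<open>w' \<le> w\<close> r in_X mem by (intro monotone_onD[OF anti]) (auto intro!: ennreal_leI)
      also have "\<dots> \<le> ennreal (1 - l) * h U + ennreal l * h V"
        using X[of "1 - l"] e[of "1 - l"] l by (simp add: w'_def)
      finally show ?thesis .
    qed
    ultimately have "h \<xi> + h \<eta> \<le> (ennreal l * h U + ennreal (1 - l) * h V) +
        (ennreal (1 - l) * h U + ennreal l * h V)"
      by (rule add_mono)
    also have "\<dots> = (ennreal l + ennreal (1 - l)) * h U + (ennreal l + ennreal (1 - l)) * h V"
      by (simp add: algebra_simps)
    finally have "h \<xi> + h \<eta> \<le> (ennreal l + ennreal (1 - l)) * h U + (ennreal l + ennreal (1 - l)) * h V" .
    then show ?thesis using l by (simp add: ennreal_plus[symmetric] del: ennreal_plus)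
  qed
qed


section \<open>Order bounds for t-norms and t-conorms\<close>

lemma comm_monoid_op_onD:
  assumes "comm_monoid_op_on p q F e"
  shows "\<lbrakk>x \<in> {p..q}; y \<in> {p..q}\<rbrakk> \<Longrightarrow> F x y \<in> {p..q}"
    and "x \<in> {p..q} \<Longrightarrow> F e x = x"
    and "x \<in> {p..q} \<Longrightarrow> F x e = x"
    and "\<lbrakk>x \<le> x'; x \<in> {p..q}; x' \<in> {p..q}; y \<in> {p..q}\<rbrakk> \<Longrightarrow> F x y \<le> F x' y"
    and "\<lbrakk>y \<le> y'; x \<in> {p..q}; y \<in> {p..q}; y' \<in> {p..q}\<rbrakk> \<Longrightarrow> F x y \<le> F x y'"
  using assms unfolding comm_monoid_op_on_def by blast+

lemmas tnorm_onD = comm_monoid_op_onD[OF tnorm_on_def[THEN iffD1]]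
lemmas tconorm_onD = comm_monoid_op_onD[OF tconorm_on_def[THEN iffD1]]

lemma tnorm_on_le_min:
  assumes "tnorm_on p q T" "x \<in> {p..q}" "y \<in> {p..q}"
  shows "T x y \<le> min x y"
proof -
  have q: "x \<le> q" "y \<le> q" "q \<in> {p..q}" using assms by auto
  show ?thesis
    using tnorm_onD(4)[OF assms(1) q(1) assms(2) q(3) assms(3)] tnorm_onD(2)[OF assms(1,3)]
      tnorm_onD(5)[OF assms(1) q(2) assms(2,3) q(3)] tnorm_onD(3)[OF assms(1,2)] by simp
qed

lemma tconorm_on_ge_max:
  assumes "tconorm_on p q S" "x \<in> {p..q}" "y \<in> {p..q}"
  shows "max x y \<le> S x y"
proof -
  have p: "p \<le> x" "p \<le> y" "p \<in> {p..q}" using assms by auto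
  show ?thesis
    using tconorm_onD(4)[OF assms(1) p(1) p(3) assms(2) assms(3)] tconorm_onD(2)[OF assms(1,3)]
      tconorm_onD(5)[OF assms(1) p(2) assms(2) p(3) assms(3)] tconorm_onD(3)[OF assms(1,2)] by simp
qed

section \<open>One pair of overlapping summands and its generators\<close>

text \<open>Each generator describes its operation on one square only, but \<open>S\<close> and
  \<open>T\<close> stay global: \<open>T x y\<close> may fall below \<open>a\<close> and
  \<open>S x z\<close> may exceed \<open>d\<close>, so both operations are also evaluated outside
  these squares.\<close>

locale summand_pair =
  fixes S T :: "real \<Rightarrow> real \<Rightarrow> real" and a b c d :: real and s t :: "real \<Rightarrow> ennreal"
  assumes S: "tconorm_on 0 1 S" and T: "tnorm_on 0 1 T"
    and a0: "0 \<le> a" and b1: "b \<le> 1" and c0: "0 \<le> c" and d1: "d \<le> 1"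
    and ab: "a < b" and cd: "c < d" and overlap: "max a c < min b d"
    and s: "tconorm_generator a b S s" and t: "tnorm_generator c d T t"
begin

abbreviation "l \<equiv> max a c"
abbreviation "r \<equiv> min b d"
abbreviation "t_inv \<equiv> inv_into {c..d} t"
abbreviation "s_inv \<equiv> inv_into {a..b} s"

lemma s_simps [simp]:
  assumes "x \<in> {a..b}" "y \<in> {a..b}"
  shows "s x < s y \<longleftrightarrow> x < y" "s x \<le> s y \<longleftrightarrow> x \<le> y" "s x = s y \<longleftrightarrow> x = y"
  using s assms unfolding tconorm_generator_def
  by (auto simp: strict_mono_on_less strict_mono_on_less_eq strict_mono_on_eq)

lemma t_less [simp]:
  assumes "x \<in> {c..d}" "y \<in> {c..d}"
  shows "t x < t y \<longleftrightarrow> y < x"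
proof -
  have "t u > t v" if "u < v" "u \<in> {c..d}" "v \<in> {c..d}" for u v
    using t monotone_onD[of "{c..d}" "(<)" "(>)" t u v] that unfolding tnorm_generator_def by blast
  from this[of x y] this[of y x] assms show ?thesis
    by (cases x y rule: linorder_cases) auto
qed

lemma t_simps [simp]:
  assumes "x \<in> {c..d}" "y \<in> {c..d}"
  shows "t x \<le> t y \<longleftrightarrow> y \<le> x" "t x = t y \<longleftrightarrow> x = y"
  using t_less[OF assms] t_less[OF assms(2,1)] by (metis not_less, metis less_irrefl linorder_neqE)

lemma ends [simp]: "s a = 0" "t d = 0"
  using s t by (simp_all add: tconorm_generator_def tnorm_generator_def)

lemma continuous_t: "\<lbrakk>c \<le> p; q \<le> d\<rbrakk> \<Longrightarrow> continuous_on {p..q} t"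
  using t continuous_on_subset[of "{c..d}" t "{p..q}"] by (simp add: tnorm_generator_def)

lemma continuous_s: "continuous_on {a..b} s"
  using s by (simp add: tconorm_generator_def)

lemma t_fin:
  assumes "x \<in> {c<..d}"
  shows "t x < \<infinity>"
proof -
  have "t x < t c" using assms cd by simp
  then show ?thesis by (rule less_le_trans) simp
qed

lemma s_fin:
  assumes "x \<in> {a..<b}"
  shows "s x < \<infinity>"
proof -
  have "s x < s b" using assms ab by simp
  then show ?thesis by (rule less_le_trans) simp
qed

lemma t_image:
  assumes "x \<in> {c..d}" "y \<in> {c..d}" "x \<le> y"
  shows "{t y..t x} = t ` {x..y}"
proof (intro equalityI subsetI)
  fix e assume e: "e \<in> {t y..t x}"
  have "continuous_on {x..y} t" using assms by (intro continuous_t) auto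
  then have "\<exists>w. x \<le> w \<and> w \<le> y \<and> t w = e"
    using e assms(3) by (intro IVT2') simp_all
  then show "e \<in> t ` {x..y}" by auto
next
  fix e assume "e \<in> t ` {x..y}"
  then obtain w where "w \<in> {x..y}" "e = t w" by blast
  then show "e \<in> {t y..t x}" using assms by simp
qed

lemma s_image: "{0..s b} = s ` {a..b}"
proof (intro equalityI subsetI)
  fix e assume e: "e \<in> {0..s b}"
  then have "\<exists>w. a \<le> w \<and> w \<le> b \<and> s w = e"
    using ab by (intro IVT' continuous_s) simp_all
  then show "e \<in> s ` {a..b}" by auto
next
  fix e assume "e \<in> s ` {a..b}"
  then obtain w where "w \<in> {a..b}" "e = s w" by blast
  then show "e \<in> {0..s b}" using ab by simp
qed

lemma t_inv:
  assumes "e \<le> t c"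
  shows "t_inv e \<in> {c..d}" "t (t_inv e) = e"
proof -
  have "e \<in> t ` {c..d}" using t_image[of c d] assms cd by auto
  from inv_into_into[OF this] f_inv_into_f[OF this]
  show "t_inv e \<in> {c..d}" "t (t_inv e) = e" by this+
qed

lemma s_inv:
  assumes "e \<le> s b"
  shows "s_inv e \<in> {a..b}" "s (s_inv e) = e"
proof -
  have "e \<in> s ` {a..b}" using s_image assms by auto
  from inv_into_into[OF this] f_inv_into_f[OF this]
  show "s_inv e \<in> {a..b}" "s (s_inv e) = e" by this+
qed

lemma t_inv_t [simp]: "x \<in> {c..d} \<Longrightarrow> t_inv (t x) = x"
  by (rule inv_into_f_f) (auto intro!: inj_onI)

text \<open>For \<open>v\<close> above \<open>d\<close>, the value \<open>T v y\<close> is squeezed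
  between \<open>T d y = y\<close> and \<open>y\<close>, so \<open>v\<close> may be clipped to
  \<open>d\<close>. This covers \<open>v = S x z\<close>, which may leave the t-norm summand at the
  top.\<close>

lemma T_value:
  assumes "v \<in> {c..1}" "y \<in> {c..d}"
  shows "T v y \<in> {c..d}" "t (T v y) = min (t (min v d) + t y) (t c)"
proof -
  have *: "T u y \<in> {c..d} \<and> t (T u y) = min (t u + t y) (t c)" if "u \<in> {c..d}" for u
    using t t_inv[of "min (t u + t y) (t c)"] that assms(2) unfolding tnorm_generator_def by auto
  have "t (T d y) = t y" "T d y \<in> {c..d}" using *[of d] cd assms by (auto simp: min_def)
  then have dy: "T d y = y" using assms by (metis t_simps(2))
  have "T v y = y" if "d \<le> v"
  proof (rule antisym)
    show "T v y \<le> y"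
      using tnorm_on_le_min[OF T, of v y] assms c0 d1 by auto
    have "T d y \<le> T v y"
      using that assms c0 d1 cd by (intro tnorm_onD(4)[OF T]) auto
    then show "y \<le> T v y" using dy by simp
  qed
  with dy have "T v y = T (min v d) y"
    by (cases "d \<le> v") (simp_all add: min_absorb1 min_absorb2)
  then show "T v y \<in> {c..d}" "t (T v y) = min (t (min v d) + t y) (t c)"
    using *[of "min v d"] assms cd by auto
qed

text \<open>Dual to \<open>T_value\<close>: for \<open>u\<close> below \<open>a\<close>, the value
  \<open>S u z\<close> is squeezed between \<open>z\<close> and \<open>S a z = z\<close>. This
  covers \<open>u = T x y\<close> below the t-conorm summand.\<close>

lemma S_value:
  assumes "u \<in> {0..b}" "z \<in> {a..b}"
  shows "S u z \<in> {a..b}" "s (S u z) = min (s (max u a) + s z) (s b)"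
proof -
  have *: "S v z \<in> {a..b} \<and> s (S v z) = min (s v + s z) (s b)" if "v \<in> {a..b}" for v
    using s s_inv[of "min (s v + s z) (s b)"] that assms(2) unfolding tconorm_generator_def by auto
  have "s (S a z) = s z" "S a z \<in> {a..b}" using *[of a] ab assms by (auto simp: min_def)
  then have az: "S a z = z" using assms by (metis s_simps(3))
  have "S u z = z" if "u \<le> a"
  proof (rule antisym)
    show "z \<le> S u z"
      using tconorm_on_ge_max[OF S, of u z] assms a0 b1 by auto
    have "S u z \<le> S a z"
      using that assms a0 b1 ab by (intro tconorm_onD(4)[OF S]) auto
    then show "S u z \<le> z" using az by simp
  qed
  with az have "S u z = S (max u a) z"
    by (cases "u \<le> a") (simp_all add: max_absorb1 max_absorb2)
  then show "S u z \<in> {a..b}" "s (S u z) = min (s (max u a) + s z) (s b)"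
    using *[of "max u a"] assms ab by auto
qed

lemma h_domain: "{t r..t l} = t ` {l..r}"
  using overlap by (intro t_image) auto

text \<open>A continuous injection on a compact interval has a continuous inverse; this one maps
  \<open>{t r..t l}\<close> back to \<open>{l..r}\<close>, where \<open>s\<close> is
  continuous.\<close>

lemma h_continuous: "continuous_on {t r..t l} (s \<circ> t_inv)"
proof (rule continuous_on_compose)
  have "continuous_on {l..r} t"
    by (intro continuous_t) auto
  then show "continuous_on {t r..t l} t_inv"
    unfolding h_domain by (rule continuous_on_inv) auto
  have "(\<lambda>x. t_inv (t x)) ` {l..r} = (\<lambda>x. x) ` {l..r}" by (rule image_cong) simp_all
  then show "continuous_on (t_inv ` {t r..t l}) s"
    unfolding h_domain image_image by (intro continuous_on_subset[OF continuous_s]) simp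
qed

lemma h_antimono: "antimono_on {t r..t l} (s \<circ> t_inv)"
  unfolding h_domain by (auto intro!: monotone_onI)

section \<open>Convexity from weak domination\<close>

lemma convex_if_weakly_dominates:
  assumes "weakly_dominates S T"
  shows "ennreal_convex_on {t r..t l} (s \<circ> t_inv)"
proof (rule ennreal_convex_onI_midpoint[OF h_continuous h_antimono])
  fix p q m :: real
  assume pq: "t r \<le> ennreal p" "0 \<le> p" "p \<le> q" "ennreal q \<le> t l" and m: "2 * m = p + q"
  define v x u where "v = t_inv (ennreal p)" and "x = t_inv (ennreal m)" and "u = t_inv (ennreal q)"
  have "ennreal p \<le> ennreal m" "ennreal m \<le> ennreal q" using pq m by (auto intro!: ennreal_leI)
  then have "ennreal p \<in> t ` {l..r}" "ennreal m \<in> t ` {l..r}" "ennreal q \<in> t ` {l..r}"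
    unfolding h_domain[symmetric] atLeastAtMost_iff using pq(1,4) by (meson order_trans)+
  then have mem: "v \<in> {l..r}" "x \<in> {l..r}" "u \<in> {l..r}"
    and eq: "t v = ennreal p" "t x = ennreal m" "t u = ennreal q"
    unfolding v_def x_def u_def by auto
  have cd_mem: "v \<in> {c..d}" "x \<in> {c..d}" "u \<in> {c..d}" and ab_mem: "v \<in> {a..b}" "x \<in> {a..b}" "u \<in> {a..b}"
    using mem by auto
  have "t v \<le> t x" "t x \<le> t u" unfolding eq by fact+
  then have ord: "u \<le> x" "x \<le> v" using cd_mem by auto
  \<comment> \<open>As \<open>m\<close> is the midpoint, \<open>q - m = m - p\<close>: combining
    with the same \<open>y\<close> under \<open>T\<close> takes \<open>v\<close> to \<open>x\<close>
    and \<open>x\<close> to \<open>u\<close>.\<close>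
  define y where "y = t_inv (ennreal (q - m))"
  have "t u \<le> t c" "t x \<le> t c" "s v \<le> s b" using cd_mem ab_mem cd ab by auto
  have "ennreal (q - m) \<le> ennreal q" using pq m by (intro ennreal_leI) auto
  also have "\<dots> \<le> t c" using \<open>t u \<le> t c\<close> eq by simp
  finally have y: "y \<in> {c..d}" "t y = ennreal (q - m)" unfolding y_def by (rule t_inv)+
  have "t x + t y = t u" "t v + t y = t x"
    unfolding eq y using pq m by (simp_all add: ennreal_plus[symmetric] del: ennreal_plus)
  then have "t (T x y) = t u" "t (T v y) = t x"
    using T_value(2)[of x y] T_value(2)[of v y] y cd_mem d1 \<open>t u \<le> t c\<close> \<open>t x \<le> t c\<close> by auto
  then have Txy: "T x y = u" and Tvy: "T v y = x"
    using T_value(1)[of x y] T_value(1)[of v y] y cd_mem d1 by auto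
  have "2 * s x \<le> s v + s u"
  proof (cases "s v = \<infinity>")
    case False
    have sxv: "s x \<le> s v" using ord ab_mem by simp
    \<comment> \<open>The increment from \<open>s x\<close> to \<open>s v\<close> makes
      \<open>S x z = v\<close>.\<close>
    define z where "z = s_inv (s v - s x)"
    have "s v - s x \<le> s b" using \<open>s v \<le> s b\<close> by (rule order_trans[OF diff_le_self_ennreal])
    then have z: "z \<in> {a..b}" "s z = s v - s x" unfolding z_def by (rule s_inv)+
    have "s x + s z = s v" unfolding z using sxv by (rule add_diff_inverse_ennreal)
    then have "s (S x z) = s v"
      using S_value(2)[of x z] z(1) ab_mem a0 \<open>s v \<le> s b\<close> by auto
    then have "S x z = v" using S_value(1)[of x z] z ab_mem a0 by auto
    moreover have "x \<in> {0..1}" "y \<in> {0..1}" "z \<in> {0..1}"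
      using ab_mem y z a0 b1 c0 d1 by auto
    ultimately have "x \<le> S u z"
      using assms Txy Tvy unfolding weakly_dominates_def by metis
    then have "s x \<le> s (S u z)" using S_value(1)[of u z] z ab_mem a0 by auto
    also have "\<dots> \<le> s u + s z" using S_value(2)[of u z] z ab_mem a0 by auto
    \<comment> \<open>Adding \<open>s x\<close> on both sides and merging it with \<open>s z\<close>
      into \<open>s v\<close> avoids any cancellation between possibly infinite values.\<close>
    finally have "s x + s x \<le> s u + s z + s x" by (rule add_right_mono)
    also have "\<dots> = s u + s v" using \<open>s x + s z = s v\<close> by (simp add: ac_simps)
    finally show ?thesis by (simp add: mult_2 add.commute)
  qed auto
  then show "2 * (s \<circ> t_inv) (ennreal m) \<le> (s \<circ> t_inv) (ennreal p) + (s \<circ> t_inv) (ennreal q)"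
    by (simp add: v_def x_def u_def)
qed

section \<open>Weak domination inside a pair of summands from convexity\<close>

lemma dominates_at_if_convex:
  assumes conv: "ennreal_convex_on {t r..t l} (s \<circ> t_inv)"
    and x: "x \<in> {l<..<r}" and y: "y \<in> {c<..<d}" and z: "z \<in> {a<..<b}"
  shows "T (S x z) y \<le> S (T x y) z"
proof (rule ccontr)
  define u v w m where "u = T x y" and "v = S x z" and "w = T (S x z) y" and "m = S (T x y) z"
  assume "\<not> T (S x z) y \<le> S (T x y) z"
  then have mw: "m < w" by (simp add: m_def w_def)
  have u: "u \<in> {c..d}" "t u = min (t x + t y) (t c)"
    using T_value[of x y] x y d1 by (auto simp: u_def)
  have "u \<le> x" using tnorm_on_le_min[OF T, of x y] x y c0 d1 by (auto simp: u_def)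
  with u x c0 have "u \<in> {0..b}" by auto
  then have m: "m \<in> {a..b}" "s m = min (s (max u a) + s z) (s b)"
    using S_value[of u z] z by (auto simp: m_def u_def)
  have v: "v \<in> {a..b}" "s v = min (s x + s z) (s b)"
    using S_value[of x z] x z a0 by (auto simp: v_def)
  have "x \<le> v" using tconorm_on_ge_max[OF S, of x z] x z a0 b1 by (auto simp: v_def)
  with v x b1 have "v \<in> {c..1}" by auto
  then have w: "w \<in> {c..d}" "t w = min (t (min v d) + t y) (t c)"
    using T_value[of v y] y by (auto simp: w_def v_def)
  have um: "max u a \<le> m"
    using tconorm_on_ge_max[OF S, of u z] u z a0 b1 c0 d1 by (auto simp: m_def u_def)
  have wv: "w \<le> min v d"
    using tnorm_on_le_min[OF T, of v y] v y a0 b1 c0 d1 by (auto simp: w_def v_def)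
  have "s m < s w" using mw m w wv v by (subst s_simps) auto
  moreover have "s w \<le> s b" using m w wv v mw by (subst s_simps) auto
  \<comment> \<open>Since \<open>s m < s w \<le> s b\<close>, the truncation at \<open>s b\<close>
    is not active in \<open>s m\<close>.\<close>
  ultimately have sw: "s (max u a) + s z < s w" using m(2) by (auto simp: min_def split: if_splits)
  \<comment> \<open>Here \<open>c \<le> max u a \<le> m < w\<close>, so the truncation at
    \<open>t c\<close> is not active in \<open>t w\<close>.\<close>
  have "t w < t c" using mw w um u by (subst t_less) auto
  then have tw: "t w = t (min v d) + t y" using w(2) by (auto simp: min_def split: if_splits)
  let ?U = "t (max u a)" and ?V = "t (min v d)"
  have memU: "max u a \<in> {l..r}" and memV: "min v d \<in> {l..r}" and memw: "w \<in> {l..r}" and memx: "x \<in> {l..r}"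
    using u v w um wv mw \<open>u \<le> x\<close> \<open>x \<le> v\<close> x by auto
  \<comment> \<open>Clipping \<open>u\<close> from below and truncating at \<open>t c\<close> can
    only lower the left side of the sum inequality.\<close>
  have "?U \<le> t u" using u(1) memU by (subst t_simps) auto
  also have "\<dots> \<le> t x + t y" using u by simp
  finally have "?U + ?V \<le> t x + t y + ?V" by (rule add_right_mono)
  also have "\<dots> = t x + t w" using tw by (simp add: ac_simps)
  finally have sum: "?U + ?V \<le> t x + t w" .
  \<comment> \<open>Convexity speaks of finite arguments only, and \<open>t c\<close> may be
    infinite. Both \<open>x\<close> and \<open>w\<close> lie strictly above \<open>c\<close>, and
    the sum inequality passes finiteness on to \<open>?U\<close>.\<close>
  have "t x < \<infinity>" "t w < \<infinity>" using t_fin[of x] t_fin[of w] x memw mw w um u by auto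
  then have "t x + t w < \<infinity>" by simp
  with sum have fin: "?U < \<infinity>" by (metis add_increasing2 le_less_trans order_refl zero_le)
  have "(s \<circ> t_inv) (t x) + (s \<circ> t_inv) (t w) \<le> (s \<circ> t_inv) ?U + (s \<circ> t_inv) ?V"
  proof (rule ennreal_convex_on_majorization[OF conv h_antimono _ _ _ _ _ _ _ _ fin sum])
    show "?U \<in> {t r..t l}" "?V \<in> {t r..t l}" "t x \<in> {t r..t l}" "t w \<in> {t r..t l}"
      unfolding h_domain using memU memV memw memx by auto
    then show "{?V..?U} \<subseteq> {t r..t l}" by auto
    show "?V \<le> t x" "t x \<le> ?U" "?V \<le> t w" "t w \<le> ?U"
      using memU memV memw memx um wv mw \<open>u \<le> x\<close> \<open>x \<le> v\<close> by auto
  qed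
  then have "s x + s w \<le> s (max u a) + s (min v d)"
    using memU memV memw memx by simp
  also have "\<dots> \<le> s (max u a) + s v" using v(1) memV by (intro add_left_mono) (subst s_simps, auto)
  also have "\<dots> \<le> s (max u a) + (s x + s z)" using v(2) by (intro add_left_mono) simp
  also have "\<dots> = s x + (s (max u a) + s z)" by (simp add: ac_simps)
  \<comment> \<open>As \<open>x < b\<close>, the value \<open>s x\<close> is finite, so adding it
    preserves the strict inequality.\<close>
  also have "\<dots> < s x + s w"
    using sw s_fin[of x] x by (simp add: ennreal_add_left_cancel_less)
  finally show False by simp
qed

end

section \<open>From pairs of summands to ordinal sums\<close>

theorem theorem3p12:
  fixes S T :: "real \<Rightarrow> real \<Rightarrow> real"
    and J :: "'j set" and a b :: "'j \<Rightarrow> real" and SS :: "'j \<Rightarrow> real \<Rightarrow> real \<Rightarrow> real"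
    and I :: "'i set" and c d :: "'i \<Rightarrow> real" and TT :: "'i \<Rightarrow> real \<Rightarrow> real \<Rightarrow> real"
    and s :: "'j \<Rightarrow> real \<Rightarrow> ennreal" and t :: "'i \<Rightarrow> real \<Rightarrow> ennreal"
  assumes "tconorm_on 0 1 S" and "continuous_op_on 0 1 S"
    and "tconorm_ordinal_sum J a b SS S"
    and "tnorm_on 0 1 T" and "continuous_op_on 0 1 T"
    and "tnorm_ordinal_sum I c d TT T"
    and "\<And>j. j \<in> J \<Longrightarrow> tconorm_generator (a j) (b j) (SS j) (s j)"
    and "\<And>i. i \<in> I \<Longrightarrow> tnorm_generator (c i) (d i) (TT i) (t i)"
  shows "weakly_dominates S T \<longleftrightarrow>
    (\<forall>(j, i) \<in> overlap_pairs J a b I c d.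
       let l = max (a j) (c i); r = min (b j) (d i)
       in ennreal_convex_on {t i r..t i l} (s j \<circ> inv_into {c i..d i} (t i)))"
proof -
  have J: "0 \<le> a j" "a j < b j" "b j \<le> 1" "archimedean_tconorm_on (a j) (b j) (SS j)"
    "\<And>x y. \<lbrakk>x \<in> {a j..b j}; y \<in> {a j..b j}\<rbrakk> \<Longrightarrow> S x y = SS j x y" if "j \<in> J" for j
    using assms(3) that unfolding tconorm_ordinal_sum_def interval_family_def by blast+
  have I: "0 \<le> c i" "c i < d i" "d i \<le> 1" "archimedean_tnorm_on (c i) (d i) (TT i)"
    "\<And>x y. \<lbrakk>x \<in> {c i..d i}; y \<in> {c i..d i}\<rbrakk> \<Longrightarrow> T x y = TT i x y" if "i \<in> I" for i
    using assms(6) that unfolding tnorm_ordinal_sum_def interval_family_def by blast+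
  have pair: "summand_pair S T (a j) (b j) (c i) (d i) (s j) (t i)"
    if "(j, i) \<in> overlap_pairs J a b I c d" for j i
  proof
    have ji: "j \<in> J" "i \<in> I" "{a j<..<b j} \<inter> {c i<..<d i} \<noteq> {}"
      using that by (auto simp: overlap_pairs_def)
    then show "max (a j) (c i) < min (b j) (d i)" by auto
    show "tconorm_generator (a j) (b j) S (s j)"
      using assms(7)[OF ji(1)] J(5)[OF ji(1)] unfolding tconorm_generator_def by simp
    show "tnorm_generator (c i) (d i) T (t i)"
      using assms(8)[OF ji(2)] I(5)[OF ji(2)] unfolding tnorm_generator_def by simp
    show "tconorm_on 0 1 S" "tnorm_on 0 1 T" by fact+
    show "0 \<le> a j" "b j \<le> 1" "a j < b j" using J[OF ji(1)] by simp_all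
    show "0 \<le> c i" "d i \<le> 1" "c i < d i" using I[OF ji(2)] by simp_all
  qed
  \<comment> \<open>On the boundary of a square \<open>S\<close> is the maximum: \<open>a j\<close>
    is neutral, and \<open>b j\<close> is absorbing because values lie between the maximum and
    \<open>b j\<close>.\<close>
  have S_summand: "\<exists>j\<in>J. x \<in> {a j<..<b j} \<and> y \<in> {a j<..<b j}"
    if xy: "x \<in> {0..1}" "y \<in> {0..1}" and ne: "S x y \<noteq> max x y" for x y
  proof -
    obtain j where j: "j \<in> J" "x \<in> {a j..b j}" "y \<in> {a j..b j}"
      using assms(3) xy ne unfolding tconorm_ordinal_sum_def by metis
    then have SS: "S x y = SS j x y" using J(5) by blast
    have sub: "tconorm_on (a j) (b j) (SS j)"
      using J(4)[OF j(1)] by (simp add: archimedean_tconorm_on_def)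
    have "SS j x y \<le> b j" "x = a j \<Longrightarrow> SS j x y = y" "y = a j \<Longrightarrow> SS j x y = x"
      using tconorm_onD(1-3)[OF sub] j by auto
    moreover have "max x y \<le> S x y" using tconorm_on_ge_max[OF assms(1)] xy by blast
    ultimately have "x \<noteq> a j" "y \<noteq> a j" "x \<noteq> b j" "y \<noteq> b j"
      using ne SS j by (auto simp: max_def split: if_splits)
    then show ?thesis using j by (intro bexI[of _ j]) auto
  qed
  \<comment> \<open>Dually, \<open>d i\<close> is neutral and \<open>c i\<close> is
    absorbing.\<close>
  have T_summand: "\<exists>i\<in>I. x \<in> {c i<..<d i} \<and> y \<in> {c i<..<d i}"
    if xy: "x \<in> {0..1}" "y \<in> {0..1}" and ne: "T x y \<noteq> min x y" for x y
  proof -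
    obtain i where i: "i \<in> I" "x \<in> {c i..d i}" "y \<in> {c i..d i}"
      using assms(6) xy ne unfolding tnorm_ordinal_sum_def by metis
    then have TT: "T x y = TT i x y" using I(5) by blast
    have sub: "tnorm_on (c i) (d i) (TT i)"
      using I(4)[OF i(1)] by (simp add: archimedean_tnorm_on_def)
    have "c i \<le> TT i x y" "x = d i \<Longrightarrow> TT i x y = y" "y = d i \<Longrightarrow> TT i x y = x"
      using tnorm_onD(1-3)[OF sub] i by auto
    moreover have "T x y \<le> min x y" using tnorm_on_le_min[OF assms(4)] xy by blast
    ultimately have "x \<noteq> c i" "y \<noteq> c i" "x \<noteq> d i" "y \<noteq> d i"
      using ne TT i by (auto simp: min_def split: if_splits)
    then show ?thesis using i by (intro bexI[of _ i]) auto
  qed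
  show ?thesis
  proof
    assume "weakly_dominates S T"
    then show "\<forall>(j, i) \<in> overlap_pairs J a b I c d.
       let l = max (a j) (c i); r = min (b j) (d i)
       in ennreal_convex_on {t i r..t i l} (s j \<circ> inv_into {c i..d i} (t i))"
      using summand_pair.convex_if_weakly_dominates[OF pair] by (auto simp: Let_def)
  next
    assume conv: "\<forall>(j, i) \<in> overlap_pairs J a b I c d.
       let l = max (a j) (c i); r = min (b j) (d i)
       in ennreal_convex_on {t i r..t i l} (s j \<circ> inv_into {c i..d i} (t i))"
    show "weakly_dominates S T"
      unfolding weakly_dominates_def
    proof (intro ballI)
      fix x y z :: real
      assume xyz: "x \<in> {0..1}" "y \<in> {0..1}" "z \<in> {0..1}"
      have mem: "T x y \<in> {0..1}" "S x z \<in> {0..1}" using tconorm_onD(1)[OF assms(1)] tnorm_onD(1)[OF assms(4)] xyz by blast+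
      have bounds: "max (T x y) z \<le> S (T x y) z" "T (S x z) y \<le> min (S x z) y"
        using tconorm_on_ge_max[OF assms(1)] tnorm_on_le_min[OF assms(4)] mem xyz by blast+
      show "T (S x z) y \<le> S (T x y) z"
      proof (cases "T x y = min x y \<or> S x z = max x z")
        case True
        \<comment> \<open>If \<open>T x y\<close> or \<open>S x z\<close> equals \<open>x\<close>,
          one side collapses and a bound on the other finishes. If \<open>T x y = y\<close>, then
          \<open>y\<close> separates the two sides; if \<open>S x z = z\<close>, then
          \<open>z\<close> does.\<close>
        have "T x y \<le> S (T x y) z" "S x z = x \<Longrightarrow> T (S x z) y = T x y" "T x y = x \<Longrightarrow> S (T x y) z = S x z"
          using bounds by auto
        moreover have "S x z = z \<Longrightarrow> T (S x z) y \<le> S (T x y) z" using bounds by auto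
        moreover have "T x y = y \<Longrightarrow> T (S x z) y \<le> S (T x y) z" using bounds by auto
        ultimately show ?thesis using True bounds by (auto simp: min_def max_def split: if_splits)
      next
        case False
        then obtain j i where j: "j \<in> J" "x \<in> {a j<..<b j}" "z \<in> {a j<..<b j}"
          and i: "i \<in> I" "x \<in> {c i<..<d i}" "y \<in> {c i<..<d i}"
          using S_summand T_summand xyz by meson
        \<comment> \<open>The common argument \<open>x\<close> lies in both open intervals, so the
          summands overlap.\<close>
        then have ji: "(j, i) \<in> overlap_pairs J a b I c d" by (auto simp: overlap_pairs_def)
        then have "ennreal_convex_on {t i (min (b j) (d i))..t i (max (a j) (c i))}
            (s j \<circ> inv_into {c i..d i} (t i))"
          using conv by (auto simp: Let_def)
        from summand_pair.dominates_at_if_convex[OF pair[OF ji] this, of x y z] i j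
        show ?thesis by auto
      qed
    qed
  qed
qed

end
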